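(* Let $V$ be the vector space (over the ground field) with basis $u(1),u(2),u(3),u(12),u(13),u(23)$ and let $R\subset V\otimes V$ be the span of the five elements (with $[x,y]=x\otimes y-y\otimes x$ and tensor signs omitted) $$r_1=[u(1),u(2)]+u(12)(u(2)-u(1)),$$ $$r_2=[u(2),u(3)]+u(23)(u(3)-u(2)),$$ $$r_3=[u(3),u(1)]+u(13)(u(1)-u(3)),$$ $$r_4=[u(12),u(23)]+[u(12),u(3)]+[u(1),u(23)]-u(13)(u(12)-u(23)),$$ $$r_5=[u(12),u(13)]+[u(12),u(3)]+[u(2),u(13)]-u(23)(u(12)-u(13)).$$ Then the quadratic algebra $K_3=T(V)/(R)$ is Koszul.
   Context: The ground field is not specified. $T(V)$ is the tensor algebra of $V$ and $(R)$ is the two-sided ideal generated by $R$. A quadratic algebra $A=\{V,R\}$, with $V$ the span of the generators and $R\subset V\otimes V$ the span of the generating relations, is called Koszul if for every $n$ the collection of $n-1$ subspaces $\{V^{\otimes (i-1)}\otimes R\otimes V^{\otimes (n-i-1)}\}_{1\le i\le n-1}$ generates a distributive lattice (under sum and intersection of subspaces) in $V^{\otimes n}$. The algebra $K_3$ is the quotient $Q_3(G)$, for $G$ the complete graph on three vertices, of the algebra $Q_3$ of pseudo-roots of a generic noncommutative polynomial. *)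

theory Defs
  imports Complex_Main "HOL-Library.Poly_Mapping"
begin

text \<open>
  If \<open>V\<close> is the \<open>'k\<close>-vector space with basis \<open>'x\<close>, then \<open>T(V)\<close> is the monoid algebra of the free
  monoid on \<open>'x\<close>: the basis tensor \<open>x1 \<otimes> \<dots> \<otimes> xn\<close> is the word \<open>x1 \<dots> xn\<close>, and the product of
  \<open>T(V)\<close> (written \<open>*\<close>) is the tensor product.  A wrapper around lists is used so that no
  arithmetic type class is instantiated on \<open>list\<close> itself.
\<close>

datatype 'a free_monoid = Word (letters: "'a list")

instantiation free_monoid :: (type) monoid_add
begin

definition zero_free_monoid :: "'a free_monoid"
  where "0 = Word []"

definition plus_free_monoid :: "'a free_monoid \<Rightarrow> 'a free_monoid \<Rightarrow> 'a free_monoid"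
  where "v + w = Word (letters v @ letters w)"

instance
  by standard (simp_all add: zero_free_monoid_def plus_free_monoid_def)

end

type_synonym ('x, 'k) tensor_algebra = "'x free_monoid \<Rightarrow>\<^sub>0 'k"

definition tscale :: "'k::field \<Rightarrow> ('x, 'k) tensor_algebra \<Rightarrow> ('x, 'k) tensor_algebra"
  where "tscale c p = Poly_Mapping.single 0 c * p"

global_interpretation tensor: vector_space tscale
  defines tspan = tensor.span
    and tsubspace = tensor.subspace
  by unfold_locales
    (simp_all add: tscale_def distrib_left distrib_right mult_single single_add single_one
      flip: mult.assoc)

text \<open>The homogeneous component \<open>V\<^sup>\<otimes>\<^sup>n\<close> of \<open>T(V)\<close>.\<close>

definition tensor_power :: "nat \<Rightarrow> ('x, 'k::field) tensor_algebra set"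
  where "tensor_power n = {p. \<forall>w \<in> Poly_Mapping.keys p. length (letters w) = n}"

text \<open>
  For subspaces \<open>A \<subseteq> V\<^sup>\<otimes>\<^sup>m\<close> and \<open>B \<subseteq> V\<^sup>\<otimes>\<^sup>n\<close>, the following is \<open>A \<otimes> B\<close> regarded as a subspace
  of \<open>V\<^sup>\<otimes>\<^sup>m\<^sup>+\<^sup>n\<close>; it is used only for such homogeneous subspaces.
\<close>

definition subspace_tensor ::
    "('x, 'k::field) tensor_algebra set \<Rightarrow> ('x, 'k) tensor_algebra set
      \<Rightarrow> ('x, 'k) tensor_algebra set"
  where "subspace_tensor A B = tspan {a * b | a b. a \<in> A \<and> b \<in> B}"

definition subspace_sum :: "'a::ab_group_add set \<Rightarrow> 'a set \<Rightarrow> 'a set"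
  where "subspace_sum X Y = {x + y | x y. x \<in> X \<and> y \<in> Y}"

inductive_set generated_lattice :: "'a::ab_group_add set set \<Rightarrow> 'a set set"
  for \<S> :: "'a set set"
where
  base: "X \<in> \<S> \<Longrightarrow> X \<in> generated_lattice \<S>"
| sum: "X \<in> generated_lattice \<S> \<Longrightarrow> Y \<in> generated_lattice \<S>
    \<Longrightarrow> subspace_sum X Y \<in> generated_lattice \<S>"
| inter: "X \<in> generated_lattice \<S> \<Longrightarrow> Y \<in> generated_lattice \<S>
    \<Longrightarrow> X \<inter> Y \<in> generated_lattice \<S>"

text \<open>As in every lattice, the dual distributive law follows from the one stated here.\<close>

definition generates_distributive_lattice :: "'a::ab_group_add set set \<Rightarrow> bool"
  where "generates_distributive_lattice \<S> \<longleftrightarrow>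
    (\<forall>X \<in> generated_lattice \<S>. \<forall>Y \<in> generated_lattice \<S>. \<forall>Z \<in> generated_lattice \<S>.
      X \<inter> subspace_sum Y Z = subspace_sum (X \<inter> Y) (X \<inter> Z))"

text \<open>
  A quadratic algebra \<open>{V, R}\<close> is given by its presentation: \<open>V\<close> is the space with basis \<open>'x\<close> (so
  it is determined by the type), and \<open>R\<close> is a subspace of \<open>V \<otimes> V\<close>.  The algebra itself is the
  quotient of \<open>T(V)\<close> by the two-sided ideal generated by \<open>R\<close>; the Koszul property is by
  definition a property of the pair.
\<close>

definition quadratic :: "('x, 'k::field) tensor_algebra set \<Rightarrow> bool"
  where "quadratic R \<longleftrightarrow> tsubspace R \<and> R \<subseteq> tensor_power 2"

text \<open>
  For \<open>n \<le> 1\<close> the index set is empty.  Otherwise \<open>i \<le> n - 1\<close>, so the truncated subtractions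
  are exact and every subspace in the collection lies in \<open>V\<^sup>\<otimes>\<^sup>n\<close>.
\<close>

definition koszul :: "('x, 'k::field) tensor_algebra set \<Rightarrow> bool"
  where "koszul R \<longleftrightarrow> quadratic R \<and>
    (\<forall>n. generates_distributive_lattice
      {subspace_tensor (subspace_tensor (tensor_power (i - 1)) R) (tensor_power (n - i - 1))
        | i. 1 \<le> i \<and> i \<le> n - 1})"

datatype generator = V1 | V2 | V3 | V12 | V13 | V23

definition u :: "generator \<Rightarrow> (generator, 'k::field) tensor_algebra"
  where "u g = Poly_Mapping.single (Word [g]) 1"

definition bracket :: "'a::ring \<Rightarrow> 'a \<Rightarrow> 'a"
  where "bracket x y = x * y - y * x"

definition r1 :: "(generator, 'k::field) tensor_algebra"
  where "r1 = bracket (u V1) (u V2) + u V12 * (u V2 - u V1)"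

definition r2 :: "(generator, 'k::field) tensor_algebra"
  where "r2 = bracket (u V2) (u V3) + u V23 * (u V3 - u V2)"

definition r3 :: "(generator, 'k::field) tensor_algebra"
  where "r3 = bracket (u V3) (u V1) + u V13 * (u V1 - u V3)"

definition r4 :: "(generator, 'k::field) tensor_algebra"
  where "r4 = bracket (u V12) (u V23) + bracket (u V12) (u V3) + bracket (u V1) (u V23)
    - u V13 * (u V12 - u V23)"

definition r5 :: "(generator, 'k::field) tensor_algebra"
  where "r5 = bracket (u V12) (u V13) + bracket (u V12) (u V3) + bracket (u V2) (u V13)
    - u V23 * (u V12 - u V13)"

definition K3_relations :: "(generator, 'k::field) tensor_algebra set"
  where "K3_relations = tspan {r1, r2, r3, r4, r5}"

end

theory Submission
  imports Defs
begin

text \<open>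
  The space \<open>R\<close> has a quadratic noncommutative Groebner basis over every field. Order
  the generators by \<open>u(3) > u(23) > u(13) > u(1) > u(2) > u(12)\<close> and words of equal length
  lexicographically. Then \<open>r3\<close>, \<open>-r2\<close>, \<open>-r4\<close>, \<open>r5 - r4\<close>, \<open>r1\<close> have leading coefficient \<open>1\<close> and the
  leading words
    \<open>u(3)u(1)\<close>, \<open>u(3)u(2)\<close>, \<open>u(3)u(12)\<close>, \<open>u(23)u(13)\<close>, \<open>u(1)u(2)\<close>.
  The only way two of these can overlap in a letter is the word \<open>u(3)u(1)u(2)\<close>, and
  \<open>R \<otimes> V \<inter> V \<otimes> R\<close> contains an element with exactly this leading word, by the identity
    \<open>r1 u(3) + r2 u(1) + r3 u(2) - r4 (u(2) - u(3)) + r5 (u(1) - u(3))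
     = (u(3) + u(13) + u(23)) r1 + (u(1) + u(12) + u(13)) r2 + (u(2) + u(12) + u(23)) r3\<close>.

  Cut a word into blocks: each \<open>u(3)u(1)u(2)\<close>, each remaining leading pair, and each remaining single
  letter. Replace the blocks by this cubic element, by the corresponding relations, and by the
  letters themselves, and multiply (\<open>K3_basis\<close>). The result has the given word as its leading
  word, so these products form a basis of \<open>T(V)\<close>. It lies in
  \<open>V\<^sup>\<otimes>\<^sup>k \<otimes> R \<otimes> V\<^sup>\<otimes>\<^sup>l\<close> as soon as the word has a leading pair at position \<open>k\<close>
  (\<open>K3_basis_placed\<close>). On the other hand every nonzero element of that subspace has a leading word
  with a leading pair at position \<open>k\<close>, so successive elimination of leading words
  (\<open>span_of_leading\<close>) shows that the subspace is spanned by exactly those basis products.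

  Hence in each degree all the subspaces in question are coordinate subspaces for one and the same
  basis. Sums and intersections of coordinate subspaces correspond to unions and
  intersections of index sets, and the distributive law is inherited from sets
  (\<open>koszul_of_adapted_monic_family\<close>).
\<close>

section \<open>Products of spans in the tensor algebra\<close>

abbreviation word :: "'x list \<Rightarrow> ('x, 'k::field) tensor_algebra"
  where "word w \<equiv> Poly_Mapping.single (Word w) 1"

lemma word_mult: "word v * word w = (word (v @ w) :: ('x, 'k::field) tensor_algebra)"
  by (simp add: mult_single plus_free_monoid_def)

lemma word_Nil: "word [] = (1 :: ('x, 'k::field) tensor_algebra)"
  by (metis single_one zero_free_monoid_def)

lemma sum_singles:
  "(\<Sum>v\<in>Poly_Mapping.keys p. Poly_Mapping.single v (Poly_Mapping.lookup p v)) = p"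
  by (rule poly_mapping_eqI)
    (simp add: lookup_sum lookup_single when_def in_keys_iff sum.delta if_distrib cong: if_cong)

lemma tscale_single: "tscale c (Poly_Mapping.single v d) = Poly_Mapping.single v (c * d)"
  by (simp add: tscale_def mult_single)

lemma tscale_mult_left: "tscale c p * q = tscale c (p * q)"
  by (simp add: tscale_def mult.assoc)

text \<open>The scalar \<open>single 0 c\<close> is central although \<open>T(V)\<close> is not commutative.\<close>

lemma tscale_mult_right:
  fixes p q :: "('x, 'k::field) tensor_algebra"
  shows "p * tscale c q = tscale c (p * q)"
proof -
  let ?p = "\<Sum>v\<in>Poly_Mapping.keys p. Poly_Mapping.single v (Poly_Mapping.lookup p v)"
  have "?p * Poly_Mapping.single 0 c = Poly_Mapping.single 0 c * ?p"
    by (simp add: sum_distrib_left sum_distrib_right mult_single mult.commute)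
  then have "p * Poly_Mapping.single 0 c = Poly_Mapping.single 0 c * p"
    by (simp add: sum_singles)
  then show ?thesis
    by (simp add: tscale_def flip: mult.assoc)
qed

lemma subspace_tensor_span:
  "subspace_tensor (tspan S) (tspan T) = tspan {s * t | s t. s \<in> S \<and> t \<in> T}"
proof (rule antisym)
  let ?U = "tspan {s * t | s t. s \<in> S \<and> t \<in> T}"
  have *: "s * b \<in> ?U" if "s \<in> S" "b \<in> tspan T" for s b
    using that(2)
  proof (induction rule: tensor.span_induct_alt)
    case (step c t y)
    have "s * t \<in> ?U" using step that by (blast intro: tensor.span_base)
    then show ?case using step
      by (simp add: distrib_left tscale_mult_right tensor.span_add tensor.span_scale)
  qed (simp add: tensor.span_zero)
  have "a * b \<in> ?U" if "a \<in> tspan S" "b \<in> tspan T" for a b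
    using that(1)
  proof (induction rule: tensor.span_induct_alt)
    case (step c s y)
    then show ?case using * that
      by (simp add: distrib_right tscale_mult_left tensor.span_add tensor.span_scale)
  qed (simp add: tensor.span_zero)
  then show "subspace_tensor (tspan S) (tspan T) \<subseteq> ?U"
    unfolding subspace_tensor_def
    by (intro tensor.span_minimal tensor.subspace_span) auto
  show "?U \<subseteq> subspace_tensor (tspan S) (tspan T)"
    unfolding subspace_tensor_def
    by (intro tensor.span_mono) (blast intro: tensor.span_base)
qed

lemma tensor_power_span:
  "(tensor_power n :: ('x, 'k::field) tensor_algebra set) = tspan (word ` {w. length w = n})"
  (is "?T = ?S")
proof (rule antisym)
  show "?S \<subseteq> ?T"
  proof
    fix p :: "('x, 'k) tensor_algebra"
    assume "p \<in> tspan (word ` {w. length w = n})"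
    then show "p \<in> tensor_power n"
    proof (induction rule: tensor.span_induct_alt)
      case (step c x y)
      have "Poly_Mapping.keys (tscale c x + y) \<subseteq> Poly_Mapping.keys x \<union> Poly_Mapping.keys y"
        using step(1) keys_add[of "tscale c x" y] by (auto simp: tscale_single split: if_splits)
      with step show ?case by (auto simp: tensor_power_def)
    qed (simp add: tensor_power_def)
  qed
  show "?T \<subseteq> ?S"
  proof
    fix p :: "('x, 'k) tensor_algebra" assume p: "p \<in> tensor_power n"
    have "Poly_Mapping.single v c \<in> tspan (word ` {w. length w = n})"
      if "v \<in> Poly_Mapping.keys p" for v :: "'x free_monoid" and c :: 'k
    proof -
      have "word (letters v) \<in> tspan (word ` {w. length w = n} :: ('x, 'k) tensor_algebra set)"
        using p that
        by (intro tensor.span_base image_eqI[of _ _ "letters v"]) (auto simp: tensor_power_def)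
      from tensor.span_scale[OF this, of c] show ?thesis by (simp add: tscale_single)
    qed
    then show "p \<in> tspan (word ` {w. length w = n})"
      by (subst sum_singles[symmetric]) (intro tensor.span_sum)
  qed
qed

lemma subspace_tensor_power: "tsubspace (tensor_power n)"
  unfolding tensor_power_span by (rule tensor.subspace_span)

lemma tensor_power_mult: "p \<in> tensor_power m \<Longrightarrow> q \<in> tensor_power n \<Longrightarrow> p * q \<in> tensor_power (m + n)"
  using keys_mult[of p q] by (fastforce simp: tensor_power_def plus_free_monoid_def)

lemma word_tensor_power: "length w = n \<Longrightarrow> word w \<in> tensor_power n"
  by (simp add: tensor_power_def)

text \<open>
  The subspace \<open>V\<^sup>\<otimes>\<^sup>k \<otimes> R \<otimes> V\<^sup>\<otimes>\<^sup>l\<close>. Counting the factors on both sides, instead of a position and a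
  total degree, avoids subtraction.
\<close>

definition placed :: "('x, 'k::field) tensor_algebra set \<Rightarrow> nat \<Rightarrow> nat \<Rightarrow> ('x, 'k) tensor_algebra set"
  where "placed R k l = subspace_tensor (subspace_tensor (tensor_power k) R) (tensor_power l)"

lemma subspace_placed: "tsubspace (placed R k l)"
  unfolding placed_def subspace_tensor_def by (rule tensor.subspace_span)

lemma placed_span:
  "placed (tspan S) k l
    = tspan {word v * r * word w | v r w. length v = k \<and> r \<in> S \<and> length w = l}"
  unfolding placed_def tensor_power_span subspace_tensor_span
  by (rule arg_cong[where f = tspan]) blast

lemma placed_I:
  "x \<in> tensor_power k \<Longrightarrow> r \<in> R \<Longrightarrow> y \<in> tensor_power l \<Longrightarrow> x * r * y \<in> placed R k l"
  unfolding placed_def subspace_tensor_def by (blast intro: tensor.span_base)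

text \<open>
  Multiplying by homogeneous elements only lengthens the two outer tensor factors; this moves
  membership from a block of a product to the whole product.
\<close>

lemma placed_mult:
  assumes p: "p \<in> placed (tspan S) k l" and x: "x \<in> tensor_power a" and y: "y \<in> tensor_power b"
  shows "x * p * y \<in> placed (tspan S) (a + k) (l + b)"
  using p unfolding placed_span[of S k l]
proof (induction rule: tensor.span_induct_alt)
  case base
  then show ?case by (simp add: tensor.subspace_0[OF subspace_placed])
next
  case (step c q z)
  then obtain v r w where q: "q = word v * r * word w" "length v = k" "r \<in> S" "length w = l"
    by blast
  have "(x * word v) * r * (word w * y) \<in> placed (tspan S) (a + k) (l + b)"
    using q x y by (intro placed_I tensor_power_mult word_tensor_power tensor.span_base)
  then have "x * q * y \<in> placed (tspan S) (a + k) (l + b)"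
    by (simp add: q mult.assoc)
  with step show ?case
    by (simp add: distrib_left distrib_right tscale_mult_left tscale_mult_right
        tensor.subspace_add[OF subspace_placed] tensor.subspace_scale[OF subspace_placed])
qed

section \<open>Lattices of coordinate subspaces\<close>

lemma subspace_sum_span: "subspace_sum (tspan S) (tspan T) = tspan (S \<union> T)"
  by (simp add: subspace_sum_def tensor.span_Un)

text \<open>
  If the generating subspaces are spanned by parts of one family \<open>b\<close>, and intersecting such spans
  amounts to intersecting index sets, then every member of the lattice is again of this form and
  the distributive law becomes the one for index sets. The set \<open>W\<close> bounds the indices, so that
  the lemma applies to one degree of \<open>T(V)\<close> at a time.
\<close>

lemma generates_distributive_lattice_coordinate:
  fixes b :: "'w \<Rightarrow> ('x, 'k::field) tensor_algebra"
  assumes inter: "\<And>C D. C \<subseteq> W \<Longrightarrow> D \<subseteq> W \<Longrightarrow>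
      tspan (b ` C) \<inter> tspan (b ` D) = tspan (b ` (C \<inter> D))"
    and gen: "\<And>X. X \<in> \<S> \<Longrightarrow> \<exists>C\<subseteq>W. X = tspan (b ` C)"
  shows "generates_distributive_lattice \<S>"
proof -
  have coord: "\<exists>C\<subseteq>W. X = tspan (b ` C)" if "X \<in> generated_lattice \<S>" for X
    using that
  proof induction
    case (sum X Y)
    then obtain C D where "C \<subseteq> W" "D \<subseteq> W" "X = tspan (b ` C)" "Y = tspan (b ` D)" by blast
    then show ?case by (intro exI[of _ "C \<union> D"]) (simp add: subspace_sum_span image_Un)
  next
    case (inter X Y)
    then obtain C D where "C \<subseteq> W" "D \<subseteq> W" "X = tspan (b ` C)" "Y = tspan (b ` D)" by blast
    then show ?case using assms(1)[of C D] by (intro exI[of _ "C \<inter> D"]) auto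
  qed (rule gen)
  show ?thesis
    unfolding generates_distributive_lattice_def
  proof (intro ballI)
    fix X Y Z
    assume "X \<in> generated_lattice \<S>" "Y \<in> generated_lattice \<S>" "Z \<in> generated_lattice \<S>"
    then obtain C D E where W: "C \<subseteq> W" "D \<subseteq> W" "E \<subseteq> W"
      and eq: "X = tspan (b ` C)" "Y = tspan (b ` D)" "Z = tspan (b ` E)"
      using coord by meson
    have "X \<inter> subspace_sum Y Z = tspan (b ` (C \<inter> (D \<union> E)))"
      using W inter[of C "D \<union> E"] by (simp add: eq subspace_sum_span image_Un)
    also have "\<dots> = subspace_sum (X \<inter> Y) (X \<inter> Z)"
      using W by (simp add: eq subspace_sum_span inter Int_Un_distrib image_Un)
    finally show "X \<inter> subspace_sum Y Z = subspace_sum (X \<inter> Y) (X \<inter> Z)" .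
  qed
qed

section \<open>Leading words\<close>

text \<open>
  Words of equal length are compared lexicographically. A word is read as a number in
  base \<open>N\<close> with the ranks as digits, which turns this order into the order of the natural numbers
  and makes its compatibility with concatenation arithmetic.
\<close>

locale ranked_letters =
  fixes rank :: "'x \<Rightarrow> nat" and N :: nat
  assumes rank_inj: "inj rank" and rank_less: "rank p < N"
begin

fun code :: "'x list \<Rightarrow> nat" where
  "code [] = 0"
| "code (p # w) = rank p * N ^ length w + code w"

lemma code_less: "code w < N ^ length w"
proof (induction w)
  case (Cons p w)
  have "code (p # w) < (rank p + 1) * N ^ length w" using Cons by (simp add: algebra_simps)
  also have "\<dots> \<le> N * N ^ length w" using rank_less[of p] by (intro mult_right_mono) auto
  finally show ?case by simp
qed simp

lemma code_inj: "length v = length w \<Longrightarrow> code v = code w \<Longrightarrow> v = w"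
proof (induction v w rule: list_induct2)
  case (Cons p v q w)
  have "N ^ length w > 0" using rank_less[of p] by simp
  then have "code (p # v) div N ^ length w = rank p" "code (q # w) div N ^ length w = rank q"
    using code_less[of v] code_less[of w] Cons(1) by simp_all
  with Cons have "rank p = rank q" by simp
  with Cons show ?case by (simp add: inj_eq[OF rank_inj])
qed simp

lemma code_append: "code (v @ w) = code v * N ^ length w + code w"
  by (induction v) (simp_all add: algebra_simps power_add)

lemma code_append_less:
  assumes "length v' = length v" "length w' = length w"
    and "code v' \<le> code v" "code w' \<le> code w" "code v' < code v \<or> code w' < code w"
  shows "code (v' @ w') < code (v @ w)"
proof -
  have N: "N > 0" using rank_less by (metis gr0I less_nat_zero_code)
  have le: "code v' * N ^ length w \<le> code v * N ^ length w"
    using assms by simp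
  show ?thesis
  proof (cases "code v' < code v")
    case True
    then have "code v' * N ^ length w < code v * N ^ length w" using N by simp
    with assms(2,4) show ?thesis unfolding code_append assms(2) by linarith
  next
    case False
    then have "code w' < code w" using assms(5) by blast
    with assms(2) le show ?thesis unfolding code_append assms(2) by linarith
  qed
qed

text \<open>
  Since the length is fixed as well, an element of \<open>lower w\<close> is homogeneous of the degree of \<open>w\<close>.
\<close>

definition lower :: "'x list \<Rightarrow> ('x, 'k::field) tensor_algebra set"
  where "lower w = {p. \<forall>v\<in>Poly_Mapping.keys p.
    length (letters v) = length w \<and> code (letters v) < code w}"

lemma lower_zero: "0 \<in> lower w"
  by (simp add: lower_def)

lemma lower_add: "p \<in> lower w \<Longrightarrow> q \<in> lower w \<Longrightarrow> p + q \<in> lower w"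
  using keys_add[of p q] by (fastforce simp: lower_def)

lemma lower_minus: "p \<in> lower w \<Longrightarrow> - p \<in> lower w"
  by (simp add: lower_def)

lemma lower_diff: "p \<in> lower w \<Longrightarrow> q \<in> lower w \<Longrightarrow> p - q \<in> lower w"
  using keys_diff[of p q] by (fastforce simp: lower_def)

lemma lower_sum: "(\<And>i. i \<in> I \<Longrightarrow> p i \<in> lower w) \<Longrightarrow> sum p I \<in> lower w"
  by (induction I rule: infinite_finite_induct) (auto simp: lower_zero lower_add)

lemma lower_single:
  "length v = length w \<Longrightarrow> code v < code w \<Longrightarrow> Poly_Mapping.single (Word v) c \<in> lower w"
  by (simp add: lower_def)

lemma lower_tscale: "p \<in> lower w \<Longrightarrow> tscale c p \<in> lower w"
  using keys_mult[of "Poly_Mapping.single 0 c" p]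
  by (fastforce simp: lower_def tscale_def zero_free_monoid_def plus_free_monoid_def
      split: if_splits)

definition monic :: "'x list \<Rightarrow> ('x, 'k::field) tensor_algebra \<Rightarrow> bool"
  where "monic w p \<longleftrightarrow> p - word w \<in> lower w"

lemma monic_add: "monic w p \<Longrightarrow> q \<in> lower w \<Longrightarrow> monic w (p + q)"
  using lower_add[of "p - word w" w q] by (simp add: monic_def algebra_simps)

lemma monic_diff: "monic w p \<Longrightarrow> q \<in> lower w \<Longrightarrow> monic w (p - q)"
  using monic_add[of w p "- q"] lower_minus[of q w] by simp

lemma monic_word: "monic w (word w)"
  by (simp add: monic_def lower_zero)

lemma monic_keys:
  assumes "monic w p" "k \<in> Poly_Mapping.keys p"
  shows "length (letters k) = length w" "code (letters k) \<le> code w"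
    "k = Word w \<or> code (letters k) < code w"
proof -
  have "Poly_Mapping.keys p \<subseteq> Poly_Mapping.keys (p - word w) \<union> {Word w}"
    using keys_add[of "p - word w" "word w"] by simp
  with assms have "k = Word w \<or> (length (letters k) = length w \<and> code (letters k) < code w)"
    unfolding monic_def lower_def by blast
  then show "length (letters k) = length w" "code (letters k) \<le> code w"
    "k = Word w \<or> code (letters k) < code w" by auto
qed

lemma monic_homogeneous: "monic w p \<Longrightarrow> p \<in> tensor_power (length w)"
  by (simp add: tensor_power_def monic_keys)

lemma monic_lower:
  assumes "monic v p" "length v = length w" "code v < code w"
  shows "p \<in> lower w"
  using assms monic_keys[OF assms(1)] by (fastforce simp: lower_def)

text \<open>
  With \<open>p = v + p'\<close> and \<open>q = w + q'\<close>, where \<open>p'\<close> and \<open>q'\<close> are lower, the difference between \<open>p q\<close> and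
  the word \<open>v w\<close> is \<open>p' q + v q'\<close>. In each summand one factor is strictly lower and the other is not
  higher.
\<close>

lemma monic_mult:
  assumes p: "monic v p" and q: "monic w q"
  shows "monic (v @ w) (p * q)"
proof -
  have *: "x * y \<in> lower (v @ w)"
    if x: "\<And>k. k \<in> Poly_Mapping.keys x \<Longrightarrow>
        length (letters k) = length v \<and> code (letters k) \<le> code v"
      and y: "\<And>k. k \<in> Poly_Mapping.keys y \<Longrightarrow>
        length (letters k) = length w \<and> code (letters k) \<le> code w"
      and strict: "x \<in> lower v \<or> y \<in> lower w"
    for x y :: "('x, 'a) tensor_algebra"
    unfolding lower_def
  proof (intro CollectI ballI)
    fix k assume "k \<in> Poly_Mapping.keys (x * y)"
    then obtain a c where k: "k = a + c" "a \<in> Poly_Mapping.keys x" "c \<in> Poly_Mapping.keys y"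
      using keys_mult[of x y] by blast
    have "code (letters a) < code v \<or> code (letters c) < code w"
      using strict k by (auto simp: lower_def)
    then show "length (letters k) = length (v @ w) \<and> code (letters k) < code (v @ w)"
      using x[OF k(2)] y[OF k(3)] by (simp add: k(1) plus_free_monoid_def code_append_less)
  qed
  have low: "p - word v \<in> lower v" "q - word w \<in> lower w"
    using assms by (simp_all add: monic_def)
  have "(p - word v) * q \<in> lower (v @ w)"
    using low monic_keys[OF q] by (intro *) (auto simp: lower_def)
  moreover have "word v * (q - word w) \<in> lower (v @ w)"
    using low by (intro *) (auto simp: lower_def)
  moreover have "p * q - word (v @ w) = (p - word v) * q + word v * (q - word w)"
    by (simp add: algebra_simps word_mult)
  ultimately show ?thesis by (simp add: monic_def lower_add)
qed

text \<open>
  The elements met during division with remainder are not normalised, so here the leading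
  coefficient is arbitrary.
\<close>

definition leading :: "'x list \<Rightarrow> ('x, 'k::field) tensor_algebra \<Rightarrow> bool"
  where "leading w p \<longleftrightarrow> (\<exists>c. c \<noteq> 0 \<and> p - tscale c (word w) \<in> lower w)"

lemma leading_key: "leading w p \<Longrightarrow> Word w \<in> Poly_Mapping.keys p"
proof -
  assume "leading w p"
  then obtain c where c: "c \<noteq> 0" "p - tscale c (word w) \<in> lower w"
    by (auto simp: leading_def)
  then have "Word w \<notin> Poly_Mapping.keys (p - tscale c (word w))"
    by (auto simp: lower_def)
  with c show ?thesis
    by (simp add: in_keys_iff lookup_minus tscale_single)
qed

lemma leading_unique:
  assumes "leading v p" "leading w p"
  shows "v = w"
proof -
  have *: "v = w \<or> code v < code w" if v: "leading v p" and w: "leading w p" for v w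
  proof -
    obtain c where "p - tscale c (word w) \<in> lower w"
      using w by (auto simp: leading_def)
    moreover have "Word v \<in> Poly_Mapping.keys (p - tscale c (word w)) \<union> {Word w}"
      using leading_key[OF v] keys_add[of "p - tscale c (word w)" "tscale c (word w)"]
      by (auto simp: tscale_single split: if_splits)
    ultimately show ?thesis by (auto simp: lower_def)
  qed
  from *[OF assms] *[OF assms(2,1)] show ?thesis by auto
qed

text \<open>
  In a linear combination of elements with distinct leading words the largest leading word
  that occurs cannot cancel.
\<close>

lemma leading_of_span:
  assumes C: "C \<subseteq> {w. length w = n}" and g: "\<And>w. w \<in> C \<Longrightarrow> monic w (g w)"
    and p: "p \<in> tspan (g ` C)" "p \<noteq> 0"
  shows "\<exists>m\<in>C. leading m p"
proof -
  obtain t r where t: "finite t" "t \<subseteq> g ` C" "p = (\<Sum>a\<in>t. tscale (r a) a)"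
    using p(1) unfolding tensor.span_explicit by blast
  \<comment> \<open>The map \<open>g\<close> need not be known to be injective: choose one index for each vector used.\<close>
  obtain T where T: "T \<subseteq> C" "inj_on g T" "t = g ` T"
    using t(2) by (auto simp: subset_image_inj)
  define U where "U = {w\<in>T. r (g w) \<noteq> 0}"
  have fin: "finite U" "finite T"
    using T(2,3) t(1) by (simp_all add: U_def finite_image_iff)
  have p_sum: "p = (\<Sum>w\<in>U. tscale (r (g w)) (g w))"
    unfolding t(3) T(3) sum.reindex[OF T(2)] U_def
    using fin by (intro sum.mono_neutral_cong_right) auto
  with p(2) have "U \<noteq> {}" by auto
  then obtain m where m: "m \<in> U" "\<And>w. w \<in> U \<Longrightarrow> code w \<le> code m"
    using fin(1) Max_in[of "code ` U"] Max_ge[of "code ` U"] by fastforce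
  have low: "g w \<in> lower m" if "w \<in> U - {m}" for w
  proof -
    have len: "length w = length m" "monic w (g w)" using that m(1) T(1) C g by (auto simp: U_def)
    moreover have "code w < code m"
      using that m(2)[of w] code_inj[OF len(1)] by fastforce
    ultimately show ?thesis by (intro monic_lower)
  qed
  have "p = (\<Sum>w\<in>U - {m}. tscale (r (g w)) (g w)) + tscale (r (g m)) (g m)"
    unfolding p_sum using fin(1) m(1) by (subst sum.remove[of U m]) simp_all
  then have "p - tscale (r (g m)) (word m)
      = (\<Sum>w\<in>U - {m}. tscale (r (g w)) (g w)) + tscale (r (g m)) (g m - word m)"
    by (simp add: tensor.scale_right_diff_distrib)
  also have "\<dots> \<in> lower m"
    using g[of m] m(1) T(1) low
    by (intro lower_add lower_sum lower_tscale) (auto simp: monic_def U_def)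
  finally show ?thesis
    using m(1) T(1) by (auto simp: leading_def U_def)
qed

text \<open>
  Division with remainder: subtracting a multiple of the family member with the same leading word
  stays inside \<open>U\<close> and lowers the leading word, so the process ends with \<open>0\<close>.
\<close>

lemma span_of_leading:
  assumes U: "tsubspace U" and b: "\<And>m. m \<in> C \<Longrightarrow> b m \<in> U" "\<And>m. m \<in> C \<Longrightarrow> monic m (b m)"
    and lead: "\<And>p. p \<in> U \<Longrightarrow> p \<noteq> 0 \<Longrightarrow> \<exists>m\<in>C. leading m p"
  shows "U = tspan (b ` C)"
proof (rule antisym)
  show "tspan (b ` C) \<subseteq> U"
    using U b by (intro tensor.span_minimal) auto
  have "p \<in> tspan (b ` C)" if "p \<in> U" "leading m p" "m \<in> C" for p m
    using that
  proof (induction "code m" arbitrary: p m rule: less_induct)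
    case less
    obtain c where c: "p - tscale c (word m) \<in> lower m"
      using less.prems by (auto simp: leading_def)
    define q where "q = p - tscale c (b m)"
    have bm: "tscale c (b m) \<in> tspan (b ` C)"
      using less.prems by (simp add: tensor.span_base tensor.span_scale)
    have qU: "q \<in> U"
      using U less.prems b by (simp add: q_def tensor.subspace_diff tensor.subspace_scale)
    have "q = (p - tscale c (word m)) - tscale c (b m - word m)"
      by (simp add: q_def tensor.scale_right_diff_distrib)
    also have "\<dots> \<in> lower m"
      using b(2)[OF less.prems(3)] by (intro lower_diff[OF c lower_tscale]) (simp add: monic_def)
    finally have q_low: "q \<in> lower m" .
    have "q \<in> tspan (b ` C)"
    proof (cases "q = 0")
      case False
      then obtain m' where m': "m' \<in> C" "leading m' q" using lead qU by blast
      have "code m' < code m" using leading_key[OF m'(2)] q_low by (auto simp: lower_def)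
      then show ?thesis using less.hyps m' qU by blast
    qed (simp add: tensor.span_zero)
    from tensor.span_add[OF this bm] show ?case by (simp add: q_def)
  qed
  with lead show "U \<subseteq> tspan (b ` C)"
    by (metis subsetI tensor.span_zero)
qed

text \<open>
  An element of both spans has its leading word in \<open>C\<close> and in \<open>D\<close>, hence, as leading words are
  unique, in \<open>C \<inter> D\<close>. Division with remainder inside the intersection then gives the claim.
\<close>

lemma span_monic_Int:
  assumes b: "\<And>w. monic w (b w)" and len: "C \<subseteq> {w. length w = n}" "D \<subseteq> {w. length w = n}"
  shows "tspan (b ` C) \<inter> tspan (b ` D) = tspan (b ` (C \<inter> D))"
proof (rule span_of_leading)
  show "tsubspace (tspan (b ` C) \<inter> tspan (b ` D))"
    by (intro tensor.subspace_inter tensor.subspace_span)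
  fix p assume "p \<in> tspan (b ` C) \<inter> tspan (b ` D)" "p \<noteq> 0"
  then obtain v w where "v \<in> C" "leading v p" "w \<in> D" "leading w p"
    using leading_of_span[OF len(1) b] leading_of_span[OF len(2) b] by blast
  then show "\<exists>m\<in>C \<inter> D. leading m p" using leading_unique by blast
qed (auto intro: b tensor.span_base)

section \<open>A criterion for the Koszul property\<close>

text \<open>
  Suppose that the relations have leading words in \<open>L\<close> and that each word \<open>w\<close> is the leading word of
  some \<open>b w\<close> lying in \<open>V\<^sup>\<otimes>\<^sup>k \<otimes> R \<otimes> V\<^sup>\<otimes>\<^sup>l\<close> simultaneously for all positions \<open>k\<close> at which \<open>w\<close> has a pair
  in \<open>L\<close>. Then the \<open>b w\<close> for the words with such a pair at position \<open>k\<close> already span that subspace: it is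
  generated by the products of a word, a relation and a word, and these have precisely the same
  leading words. Where two leading pairs of \<open>w\<close> overlap, \<open>b w\<close> must lie in the intersection of both
  subspaces; this is the substance of the hypothesis on the family.
\<close>

theorem koszul_of_adapted_monic_family:
  fixes rel :: "'x \<Rightarrow> 'x \<Rightarrow> ('x, 'k::field) tensor_algebra"
    and b :: "'x list \<Rightarrow> ('x, 'k) tensor_algebra"
    and L :: "('x \<times> 'x) set"
  defines "R \<equiv> tspan {rel p q | p q. (p, q) \<in> L}"
  assumes rel: "\<And>p q. (p, q) \<in> L \<Longrightarrow> monic [p, q] (rel p q)"
    and b: "\<And>w. monic w (b w)"
    and adapted: "\<And>w k l. length w = k + 2 + l \<Longrightarrow> (w ! k, w ! Suc k) \<in> L \<Longrightarrow> b w \<in> placed R k l"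
  shows "koszul R"
proof -
  have "quadratic R"
    using monic_homogeneous[OF rel] unfolding quadratic_def R_def
    by (intro conjI tensor.subspace_span tensor.span_minimal subspace_tensor_power)
      (fastforce simp: numeral_2_eq_2)
  have span: "placed R k l = tspan (b ` {w. length w = k + 2 + l \<and> (w ! k, w ! Suc k) \<in> L})"
    (is "_ = tspan (b ` ?C)") for k l
  proof (rule span_of_leading)
    \<comment> \<open>The obvious generators of the subspace, indexed by their leading words.\<close>
    define g where "g w = word (take k w) * rel (w ! k) (w ! Suc k) * word (drop (k + 2) w)" for w
    have split: "w = take k w @ [w ! k, w ! Suc k] @ drop (k + 2) w" if "w \<in> ?C" for w
      using that by (simp add: Cons_nth_drop_Suc)
    have g: "monic w (g w)" if "w \<in> ?C" for w
    proof -
      have "monic ((take k w @ [w ! k, w ! Suc k]) @ drop (k + 2) w) (g w)"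
        unfolding g_def using that by (intro monic_mult monic_word rel) auto
      then show ?thesis using split[OF that] by simp
    qed
    have "word v * rel p q * word w \<in> g ` ?C"
      if "length v = k" "(p, q) \<in> L" "length w = l" for v w p q
      using that by (intro image_eqI[of _ _ "v @ p # q # w"]) (auto simp: g_def nth_append)
    then have "{word v * r * word w | v r w.
        length v = k \<and> r \<in> {rel p q | p q. (p, q) \<in> L} \<and> length w = l} \<subseteq> g ` ?C"
      by blast
    then have sub: "placed R k l \<subseteq> tspan (g ` ?C)"
      unfolding R_def placed_span by (rule tensor.span_mono)
    show "\<exists>m\<in>?C. leading m p" if "p \<in> placed R k l" "p \<noteq> 0" for p
      using that sub g by (intro leading_of_span[where n = "k + 2 + l" and g = g]) auto
  qed (use b adapted in \<open>auto simp: subspace_placed\<close>)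
  have "generates_distributive_lattice {placed R (i - 1) (n - i - 1) | i. 1 \<le> i \<and> i \<le> n - 1}" for n
  proof (rule generates_distributive_lattice_coordinate[where b = b and W = "{w. length w = n}"])
    fix X assume "X \<in> {placed R (i - 1) (n - i - 1) | i. 1 \<le> i \<and> i \<le> n - 1}"
    then obtain i where "1 \<le> i" "i \<le> n - 1" "X = placed R (i - 1) (n - i - 1)" by blast
    then show "\<exists>C\<subseteq>{w. length w = n}. X = tspan (b ` C)"
      by (intro exI[of _ "{w. length w = (i - 1) + 2 + (n - i - 1)
          \<and> (w ! (i - 1), w ! Suc (i - 1)) \<in> L}"]) (auto simp: span)
  qed (rule span_monic_Int[OF b])
  then show ?thesis using \<open>quadratic R\<close> by (simp add: koszul_def placed_def)
qed

end

section \<open>A Groebner basis for the algebra K3\<close>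

text \<open>
  This order leaves a single overlap among the leading words. One overlap is unavoidable: a nonzero
  element of \<open>R \<otimes> V \<inter> V \<otimes> R\<close> has a leading word that begins and ends with a leading pair.
\<close>

fun gen_rank :: "generator \<Rightarrow> nat" where
  "gen_rank V12 = 0"
| "gen_rank V2 = 1"
| "gen_rank V1 = 2"
| "gen_rank V13 = 3"
| "gen_rank V23 = 4"
| "gen_rank V3 = 5"

interpretation K3: ranked_letters gen_rank 6
proof
  show "inj gen_rank"
  proof (rule injI)
    fix p q assume "gen_rank p = gen_rank q"
    then show "p = q" by (cases p; cases q) auto
  qed
  show "gen_rank p < 6" for p by (cases p) auto
qed

definition K3_pairs :: "(generator \<times> generator) set"
  where "K3_pairs = {(V3, V1), (V3, V2), (V3, V12), (V23, V13), (V1, V2)}"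

text \<open>
  An element of \<open>R\<close> with leading word \<open>p q\<close> and leading coefficient \<open>1\<close>. The last branch is meant for \<open>(V1, V2)\<close>; on pairs outside
  \<open>K3_pairs\<close> its value \<open>r1\<close> is a default that still lies in \<open>R\<close>.
\<close>

definition K3_rel :: "generator \<Rightarrow> generator \<Rightarrow> (generator, 'k::field) tensor_algebra"
  where "K3_rel p q =
    (if (p, q) = (V3, V1) then r3 else if (p, q) = (V3, V2) then - r2
     else if (p, q) = (V3, V12) then - r4 else if (p, q) = (V23, V13) then r5 - r4 else r1)"

lemma K3_pairs_overlap:
  "(p, q) \<in> K3_pairs \<Longrightarrow> (q, r) \<in> K3_pairs \<Longrightarrow> p = V3 \<and> q = V1 \<and> r = V2"
  by (auto simp: K3_pairs_def)

lemma r_in_K3_relations: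
  "r1 \<in> K3_relations" "r2 \<in> K3_relations" "r3 \<in> K3_relations" "r4 \<in> K3_relations"
  "r5 \<in> K3_relations"
  by (auto simp: K3_relations_def intro: tensor.span_base)

lemma subspace_K3_relations: "tsubspace K3_relations"
  unfolding K3_relations_def by (rule tensor.subspace_span)

lemma K3_rel_in_relations: "K3_rel p q \<in> K3_relations"
  unfolding K3_rel_def
  by (simp add: r_in_K3_relations tensor.subspace_neg[OF subspace_K3_relations]
      tensor.subspace_diff[OF subspace_K3_relations])

text \<open>The change from the five relations to their reduced form is unitriangular up to signs.\<close>

lemma K3_relations_span:
  "(K3_relations :: (generator, 'k::field) tensor_algebra set)
    = tspan {K3_rel p q | p q. (p, q) \<in> K3_pairs}" (is "_ = tspan ?G")
proof (rule antisym)
  have in_span: "K3_rel p q \<in> tspan ?G" if "(p, q) \<in> K3_pairs" for p q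
    using that by (blast intro: tensor.span_base)
  have "K3_rel V1 V2 \<in> tspan ?G" "- K3_rel V3 V2 \<in> tspan ?G" "K3_rel V3 V1 \<in> tspan ?G"
    "- K3_rel V3 V12 \<in> tspan ?G" "K3_rel V23 V13 - K3_rel V3 V12 \<in> tspan ?G"
    by (intro tensor.span_neg tensor.span_diff in_span; simp add: K3_pairs_def)+
  then have "{r1, r2, r3, r4, r5} \<subseteq> tspan ?G"
    by (simp add: K3_rel_def)
  then show "K3_relations \<subseteq> tspan ?G"
    unfolding K3_relations_def by (intro tensor.span_minimal tensor.subspace_span)
  show "tspan ?G \<subseteq> K3_relations"
    by (intro tensor.span_minimal subspace_K3_relations) (blast intro: K3_rel_in_relations)
qed

lemma u_word: "u p = word [p]"
  by (simp add: u_def)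

lemma word_pair: "word [p, q] = u p * u q"
  by (simp add: u_word word_mult)

lemma u_tensor_power: "u p \<in> tensor_power (Suc 0)"
  by (simp add: u_word word_tensor_power)

text \<open>In each equation the leading word comes first.\<close>

lemma K3_rel_words:
  "K3_rel V3 V1 = word [V3, V1] - word [V1, V3] + word [V13, V1] - word [V13, V3]"
  "K3_rel V3 V2 = word [V3, V2] - word [V2, V3] - word [V23, V3] + word [V23, V2]"
  "K3_rel V3 V12 = word [V3, V12] - word [V12, V23] + word [V23, V12] - word [V12, V3]
    - word [V1, V23] + word [V23, V1] + word [V13, V12] - word [V13, V23]"
  "K3_rel V23 V13 = word [V23, V13] + word [V12, V13] + word [V2, V13] - word [V13, V2]
    - word [V12, V23] - word [V1, V23] + word [V23, V1] - word [V13, V23]"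
  "K3_rel V1 V2 = word [V1, V2] - word [V2, V1] + word [V12, V2] - word [V12, V1]"
  unfolding word_pair
  by (simp_all add: K3_rel_def r1_def r2_def r3_def r4_def r5_def bracket_def algebra_simps)

lemma monic_K3_rel:
  assumes "(p, q) \<in> K3_pairs"
  shows "K3.monic [p, q] (K3_rel p q)"
  using assms unfolding K3_pairs_def
  by (auto simp only: insert_iff empty_iff Pair_inject K3_rel_words)
    (intro K3.monic_add K3.monic_diff K3.monic_word K3.lower_single; simp)+

text \<open>
  This element of \<open>R \<otimes> V\<close> also lies in \<open>V \<otimes> R\<close>. It resolves the overlap of the leading words
  \<open>u(3)u(1)\<close> and \<open>u(1)u(2)\<close>.
\<close>

definition K3_syzygy :: "(generator, 'k::field) tensor_algebra"
  where "K3_syzygy = r1 * u V3 + r2 * u V1 + r3 * u V2 - r4 * (u V2 - u V3) + r5 * (u V1 - u V3)"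

lemma K3_syzygy_right:
  "K3_syzygy = (u V3 + u V13 + u V23) * r1 + (u V1 + u V12 + u V13) * r2
    + (u V2 + u V12 + u V23) * r3"
  by (simp add: K3_syzygy_def r1_def r2_def r3_def r4_def r5_def bracket_def algebra_simps)

text \<open>
  Rewritten in terms of the relations with leading coefficient \<open>1\<close>, the only summand whose leading
  word is not below \<open>u(3)u(1)u(2)\<close> is \<open>r3 u(2)\<close>.
\<close>

lemma monic_K3_syzygy: "K3.monic [V3, V1, V2] (K3_syzygy :: (generator, 'k::field) tensor_algebra)"
proof -
  have monic: "K3.monic [p, q, v] (K3_rel p q * u v :: (generator, 'k) tensor_algebra)"
    if "(p, q) \<in> K3_pairs" for p q v
    using K3.monic_mult[OF monic_K3_rel[OF that] K3.monic_word[of "[v]"]] by (simp add: u_word)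
  have low: "(K3_rel p q * u v :: (generator, 'k) tensor_algebra) \<in> K3.lower [V3, V1, V2]"
    if "(p, q) \<in> K3_pairs" "K3.code [p, q, v] < K3.code [V3, V1, V2]" for p q v
    using monic that by (intro K3.monic_lower[where v = "[p, q, v]"]) auto
  have *: "K3_syzygy = K3_rel V3 V1 * u V2 + K3_rel V1 V2 * u V3 - K3_rel V3 V2 * u V1
      + K3_rel V3 V12 * u V2 - K3_rel V3 V12 * u V1
      + K3_rel V23 V13 * u V1 - (K3_rel V23 V13 * u V3 :: (generator, 'k) tensor_algebra)"
    by (simp add: K3_syzygy_def K3_rel_def algebra_simps)
  show ?thesis
    unfolding *
    by (intro K3.monic_add K3.monic_diff monic low) (simp_all add: K3_pairs_def)
qed

lemma one_tensor_power: "1 \<in> tensor_power 0"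
  using word_tensor_power[of "[]" 0] by (simp add: word_Nil)

lemma K3_syzygy_placed:
  "K3_syzygy \<in> placed (K3_relations :: (generator, 'k::field) tensor_algebra set) 0 1"
  "K3_syzygy \<in> placed (K3_relations :: (generator, 'k::field) tensor_algebra set) 1 0"
proof -
  let ?R = "K3_relations :: (generator, 'k) tensor_algebra set"
  have right: "r * v \<in> placed ?R 0 1" if "r \<in> ?R" "v \<in> tensor_power (Suc 0)" for r v
    using placed_I[OF one_tensor_power that] by simp
  show "K3_syzygy \<in> placed ?R 0 1"
    unfolding K3_syzygy_def
    by (intro tensor.subspace_add[OF subspace_placed] tensor.subspace_diff[OF subspace_placed]
        right r_in_K3_relations tensor.subspace_diff[OF subspace_tensor_power] u_tensor_power)
  have left: "v * r \<in> placed ?R 1 0" if "r \<in> ?R" "v \<in> tensor_power (Suc 0)" for r v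
    using placed_I[OF that(2,1) one_tensor_power] by simp
  show "K3_syzygy \<in> placed ?R 1 0"
    unfolding K3_syzygy_right
    by (intro tensor.subspace_add[OF subspace_placed] left r_in_K3_relations
        tensor.subspace_add[OF subspace_tensor_power] u_tensor_power)
qed

text \<open>
  The product over the blocks of a word, read from the left. Taking \<open>u(3)u(1)u(2)\<close> as one block
  is what puts the product into both subspaces belonging to its two overlapping leading pairs.
\<close>

fun K3_basis :: "generator list \<Rightarrow> (generator, 'k::field) tensor_algebra" where
  "K3_basis [] = 1"
| "K3_basis [p] = u p"
| "K3_basis (p # q # w) =
    (if (p, q) \<in> K3_pairs
     then if p = V3 \<and> q = V1 \<and> w \<noteq> [] \<and> hd w = V2
       then K3_syzygy * K3_basis (tl w)
       else K3_rel p q * K3_basis w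
     else u p * K3_basis (q # w))"

lemma monic_K3_basis: "K3.monic w (K3_basis w :: (generator, 'k::field) tensor_algebra)"
proof (induction w rule: K3_basis.induct)
  case 1
  show ?case using K3.monic_word[of "[]"] by (simp add: word_Nil)
next
  case (2 p)
  show ?case using K3.monic_word[of "[p]"] by (simp add: u_word)
next
  case (3 p q w)
  consider (overlap) w' where "p = V3" "q = V1" "w = V2 # w'"
    | (pair) "(p, q) \<in> K3_pairs" "\<not> (p = V3 \<and> q = V1 \<and> w \<noteq> [] \<and> hd w = V2)"
    | (letter) "(p, q) \<notin> K3_pairs"
    by (cases w) auto
  then show ?case
  proof cases
    case overlap
    then have "K3.monic w' (K3_basis w' :: (generator, 'k) tensor_algebra)"
      using 3(1) by (simp add: K3_pairs_def)
    from K3.monic_mult[OF monic_K3_syzygy this] overlap show ?thesis by (simp add: K3_pairs_def)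
  next
    case pair
    with 3(2) have "K3.monic w (K3_basis w :: (generator, 'k) tensor_algebra)" by blast
    from K3.monic_mult[OF monic_K3_rel[OF pair(1)] this] pair show ?thesis by auto
  next
    case letter
    with 3(3) have "K3.monic (q # w) (K3_basis (q # w) :: (generator, 'k) tensor_algebra)" by blast
    from K3.monic_mult[OF K3.monic_word[of "[p]"] this] letter show ?thesis by (simp add: u_word)
  qed
qed

lemma K3_basis_homogeneous: "length w = n \<Longrightarrow> K3_basis w \<in> tensor_power n"
  using K3.monic_homogeneous[OF monic_K3_basis] by blast

lemma K3_placed_mult:
  assumes "p \<in> placed K3_relations k l" "x \<in> tensor_power a" "y \<in> tensor_power b"
  shows "x * p * y \<in> placed K3_relations (a + k) (l + b)"
  using placed_mult assms unfolding K3_relations_def .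

text \<open>
  A leading pair is either itself a block or one of the two halves of a cubic block: a pair that
  started at the last letter of a block ending in a leading pair would overlap this pair, so that
  both together would be \<open>u(3)u(1)u(2)\<close>. In the induction, the first block either contains
  the pair at position \<open>k\<close> or lies entirely to the left of it.
\<close>

lemma K3_basis_placed:
  "length w = k + 2 + l \<Longrightarrow> (w ! k, w ! Suc k) \<in> K3_pairs
    \<Longrightarrow> K3_basis w \<in> placed (K3_relations :: (generator, 'k::field) tensor_algebra set) k l"
proof (induction w arbitrary: k rule: K3_basis.induct)
  case (3 p q w)
  let ?R = "K3_relations :: (generator, 'k) tensor_algebra set"
  consider (overlap) w' where "p = V3" "q = V1" "w = V2 # w'"
    | (pair) "(p, q) \<in> K3_pairs" "\<not> (p = V3 \<and> q = V1 \<and> w \<noteq> [] \<and> hd w = V2)"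
    | (letter) "(p, q) \<notin> K3_pairs"
    by (cases w) auto
  then show ?case
  proof cases
    case overlap
    then have B: "K3_basis (p # q # w) = (K3_syzygy * K3_basis w' :: (generator, 'k) tensor_algebra)"
      by (simp add: K3_pairs_def)
    have hom: "K3_basis w' \<in> (tensor_power (length w') :: (generator, 'k) tensor_algebra set)"
      by (simp add: K3_basis_homogeneous)
    have "k = 0 \<or> k = 1 \<or> k = 2 \<or> k = 3 + (k - 3)" by arith
    then consider "k = 0" | "k = 1" | "k = 2" | k' where "k = 3 + k'" by blast
    then show ?thesis
    proof cases
      case 1
      with K3_placed_mult[OF K3_syzygy_placed(1) one_tensor_power hom] "3.prems" overlap
      show ?thesis unfolding B by simp
    next
      case 2
      with K3_placed_mult[OF K3_syzygy_placed(2) one_tensor_power hom] "3.prems" overlap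
      show ?thesis unfolding B by simp
    next
      case 3
      with "3.prems" overlap have "(V2, w' ! 0) \<in> K3_pairs" by (simp add: numeral_2_eq_2)
      then show ?thesis by (simp add: K3_pairs_def)
    next
      case (4 k')
      then have "K3_basis w' \<in> placed ?R k' l"
        using "3.IH"(1)[of k'] "3.prems" overlap by (simp add: K3_pairs_def numeral_3_eq_3)
      from K3_placed_mult[OF this K3.monic_homogeneous[OF monic_K3_syzygy] one_tensor_power] 4
      show ?thesis unfolding B by (simp add: numeral_3_eq_3)
    qed
  next
    case pair
    then have B: "K3_basis (p # q # w) = (K3_rel p q * K3_basis w :: (generator, 'k) tensor_algebra)"
      by auto
    have "k = 0 \<or> k = 1 \<or> k = 2 + (k - 2)" by arith
    then consider "k = 0" | "k = 1" | k' where "k = 2 + k'" by blast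
    then show ?thesis
    proof cases
      case 1
      with placed_I[OF one_tensor_power K3_rel_in_relations K3_basis_homogeneous, of w l p q] "3.prems"
      show ?thesis unfolding B by simp
    next
      case 2
      with "3.prems" obtain r w' where "w = r # w'" "(q, r) \<in> K3_pairs" by (cases w) auto
      with K3_pairs_overlap[OF pair(1)] pair(2) show ?thesis by auto
    next
      case (3 k')
      then have "K3_basis w \<in> placed ?R k' l"
        using "3.IH"(2)[of k'] "3.prems" pair by simp
      from K3_placed_mult[OF this K3.monic_homogeneous[OF monic_K3_rel[OF pair(1)]] one_tensor_power] 3
      show ?thesis unfolding B by simp
    qed
  next
    case letter
    then obtain k' where k': "k = Suc k'" using "3.prems" by (cases k) auto
    then have "K3_basis (q # w) \<in> placed ?R k' l"
      using "3.IH"(3)[of k'] "3.prems" letter by simp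
    from K3_placed_mult[OF this u_tensor_power one_tensor_power] letter
    show ?thesis by (simp add: k')
  qed
qed auto

theorem theorem6:
  shows "koszul (K3_relations :: (generator, 'k::field) tensor_algebra set)"
  unfolding K3_relations_span
  by (rule K3.koszul_of_adapted_monic_family[OF monic_K3_rel monic_K3_basis])
    (simp_all add: K3_basis_placed flip: K3_relations_span)

end
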